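(* Let $L$ be a bounded distributive lattice and let $f \colon L^n \to L$ be a polynomial function. Then for each $j \in [n]$, $x_j$ is essential in $f$ if and only if there exists a set $J \subseteq [n] \setminus \{j\}$ such that $f(\mathbf{e}_J) < f(\mathbf{e}_{J \cup \{j\}})$.
   Context: $L$ is an arbitrary (possibly infinite) bounded distributive lattice with operations $\wedge$, $\vee$, least element $0$ and greatest element $1$; $<$ is the strict part of the lattice order. $n$ is a positive integer and $[n] := \{1,\ldots,n\}$. Polynomial function: a map $f \colon L^n \to L$ which can be obtained by composition of the binary operations $\wedge$ and $\vee$, the projections, and the constant functions. For $I \subseteq [n]$, $\mathbf{e}_I \in L^n$ is the characteristic vector of $I$, i.e., the $n$-tuple whose $i$-th component is $1$ if $i \in I$ and $0$ otherwise. The $j$-th variable $x_j$ is essential in $f \colon L^n \to L$ if there are $a_1, \ldots, a_n, b \in L$ with $f(a_1, \ldots, a_{j-1}, a_j, a_{j+1}, \ldots, a_n) \neq f(a_1, \ldots, a_{j-1}, b, a_{j+1}, \ldots, a_n)$. *)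

theory Defs
  imports "HOL-Analysis.Finite_Cartesian_Product"
begin

text \<open>
  The coordinates \<open>1, \<dots>, n\<close> of an \<open>n\<close>-tuple, \<open>n \<ge> 1\<close>, are indexed by a finite type
  \<open>'n\<close>, so that \<open>L\<^sup>n\<close> is \<open>'a ^ 'n\<close>. Bounded distributive lattices are the types of
  sort \<open>{distrib_lattice, bounded_lattice}\<close>; the one-element lattice is included.
\<close>

inductive lattice_polynomial_function :: "('a::lattice ^ 'n \<Rightarrow> 'a) \<Rightarrow> bool" where
  proj: "lattice_polynomial_function (\<lambda>x. x $ i)"
| const: "lattice_polynomial_function (\<lambda>x. c)"
| inf: "lattice_polynomial_function f \<Longrightarrow> lattice_polynomial_function g \<Longrightarrow>
    lattice_polynomial_function (\<lambda>x. inf (f x) (g x))"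
| sup: "lattice_polynomial_function f \<Longrightarrow> lattice_polynomial_function g \<Longrightarrow>
    lattice_polynomial_function (\<lambda>x. sup (f x) (g x))"

definition char_vec :: "'n set \<Rightarrow> 'a::bounded_lattice ^ 'n" where
  "char_vec I = (\<chi> i. if i \<in> I then top else bot)"

definition essential :: "'n \<Rightarrow> ('a ^ 'n \<Rightarrow> 'b) \<Rightarrow> bool" where
  "essential j f \<longleftrightarrow> (\<exists>a b. f a \<noteq> f (\<chi> i. if i = j then b else a $ i))"

end

theory Submission
  imports Defs
begin

text \<open>
  A polynomial function \<open>f\<close> is monotone and satisfies the Shannon decomposition
  \<open>f x = f (x[i := 0]) \<squnion> (x\<^sub>i \<sqinter> f (x[i := 1]))\<close>. Decomposing at every coordinate but \<open>j\<close>
  reduces the equality of \<open>f (x[j := 0])\<close> and \<open>f (x[j := 1])\<close> to the case where \<open>x\<close> is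
  a characteristic vector; decomposing at \<open>j\<close> then shows that the value of \<open>x\<^sub>j\<close> is irrelevant.
\<close>

definition upd :: "'a ^ 'n \<Rightarrow> 'n \<Rightarrow> 'a \<Rightarrow> 'a ^ 'n" where
  "upd x i c = (\<chi> k. if k = i then c else x $ k)"

lemma upd_nth [simp]: "upd x i c $ k = (if k = i then c else x $ k)"
  by (simp add: upd_def)

lemma upd_upd [simp]: "upd (upd x i b) i c = upd x i c"
  by (simp add: vec_eq_iff)

lemma upd_same [simp]: "upd x i (x $ i) = x"
  by (simp add: vec_eq_iff)

lemma upd_commute: "i \<noteq> j \<Longrightarrow> upd (upd x i b) j c = upd (upd x j c) i b"
  by (simp add: vec_eq_iff)

lemma polynomial_mono:
  assumes "lattice_polynomial_function f" and "\<And>i. x $ i \<le> y $ i"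
  shows "f x \<le> f y"
  using assms by induction (auto intro: le_infI1 le_infI2 le_supI1 le_supI2)

text \<open>Expanding the left side gives two cross terms, \<open>inf a (inf x d)\<close> and
  \<open>inf (inf x b) c\<close>. The hypotheses put both below \<open>inf x (inf b d)\<close>,
  which absorbs them. This is the meet case of the decomposition, with monotonicity supplying the
  hypotheses.\<close>

lemma inf_decompositions:
  fixes a b c d x :: "'a::distrib_lattice"
  assumes "a \<le> b" "c \<le> d"
  shows "inf (sup a (inf x b)) (sup c (inf x d)) = sup (inf a c) (inf x (inf b d))"
proof (rule order.antisym)
  have "inf a (inf x d) \<le> inf x (inf b d)" and "inf (inf x b) c \<le> inf x (inf b d)"
    using assms by (auto intro: le_infI1 le_infI2)
  moreover have "inf (inf x b) (inf x d) \<le> inf x (inf b d)"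
    by (auto intro: le_infI1 le_infI2)
  ultimately show "inf (sup a (inf x b)) (sup c (inf x d)) \<le> sup (inf a c) (inf x (inf b d))"
    by (auto simp: inf_sup_distrib1 inf_sup_distrib2 intro: le_supI2)
  have "inf x (inf b d) \<le> inf x b" and "inf x (inf b d) \<le> inf x d"
    by (auto intro: le_infI2)
  then show "sup (inf a c) (inf x (inf b d)) \<le> inf (sup a (inf x b)) (sup c (inf x d))"
    by (auto simp del: le_inf_iff intro!: inf_greatest intro: le_infI1 le_infI2 le_supI1 le_supI2)
qed

text \<open>Constants and projections to coordinates other than \<open>i\<close> hold by absorption,
  joins by distributivity.\<close>

lemma polynomial_decomposition:
  fixes f :: "'a::{distrib_lattice, bounded_lattice} ^ 'n \<Rightarrow> 'a"
  assumes "lattice_polynomial_function f"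
  shows "f x = sup (f (upd x i bot)) (inf (x $ i) (f (upd x i top)))"
  using assms
proof induction
  case (inf f g)
  have "f (upd x i bot) \<le> f (upd x i top)" "g (upd x i bot) \<le> g (upd x i top)"
    using inf.hyps by (auto intro: polynomial_mono)
  then show ?case
    using inf.IH by (metis inf_decompositions)
next
  case (sup f g)
  then show ?case
    by (metis (no_types, lifting) inf_sup_distrib1 sup.assoc sup.left_commute)
qed (auto simp: inf.commute)

lemma upd_eq_of_char_vec_eq:
  fixes f :: "'a::{distrib_lattice, bounded_lattice} ^ 'n::finite \<Rightarrow> 'a"
  assumes f: "lattice_polynomial_function f"
    and eq: "\<And>J. j \<notin> J \<Longrightarrow> f (char_vec J) = f (char_vec (insert j J))"
  shows "f (upd x j bot) = f (upd x j top)"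
proof -
  \<comment> \<open>\<open>S\<close> contains every coordinate at which \<open>x\<close> may take a
    value other than \<open>bot\<close> and \<open>top\<close>; for \<open>S = UNIV\<close> nothing
    is demanded of \<open>x\<close>.\<close>
  have "f (upd x j bot) = f (upd x j top)"
    if "\<And>i. i \<notin> S \<Longrightarrow> x $ i \<in> {bot, top}" for S and x :: "'a ^ 'n"
    using finite[of S] that
  proof (induction S arbitrary: x rule: finite_induct)
    case empty
    define J where "J = {i. x $ i = top} - {j}"
    have "upd x j bot = char_vec J" "upd x j top = char_vec (insert j J)"
      using empty by (auto simp: vec_eq_iff char_vec_def J_def)
    then show ?case
      using eq[of J] by (simp add: J_def)
  next
    case (insert i S)
    \<comment> \<open>Overwriting coordinate \<open>i\<close> by \<open>bot\<close> or
      \<open>top\<close> leaves only \<open>S\<close> as possible exceptions.\<close>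
    have IH: "f (upd (upd x i c) j bot) = f (upd (upd x i c) j top)" if "c \<in> {bot, top}" for c
      by (rule insert.IH) (use that insert.prems in auto)
    show ?case
    proof (cases "i = j")
      case True
      then show ?thesis
        using IH[of bot] by simp
    next
      case False
      then have swap: "upd (upd x j b) i c = upd (upd x i c) j b" for b c
        by (simp add: upd_commute)
      \<comment> \<open>Both sides are decomposed at \<open>i\<close>; as \<open>i\<close> differs
        from \<open>j\<close>, the coefficient \<open>x $ i\<close> is the same in both, and the
        induction hypothesis matches the remaining parts.\<close>
      show ?thesis
        using False IH[of bot] IH[of top]
        by (simp add: polynomial_decomposition[OF f, of "upd x j _" i] swap)
    qed
  qed
  from this[of UNIV] show ?thesis by simp
qed

theorem proposition4:
  fixes f :: "'a::{distrib_lattice, bounded_lattice} ^ 'n::finite \<Rightarrow> 'a"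
    and j :: 'n
  assumes "lattice_polynomial_function f"
  shows "essential j f \<longleftrightarrow>
    (\<exists>J \<subseteq> UNIV - {j}. f (char_vec J) < f (char_vec (J \<union> {j})))"
proof
  assume ess: "essential j f"
  show "\<exists>J \<subseteq> UNIV - {j}. f (char_vec J) < f (char_vec (J \<union> {j}))"
  proof (rule ccontr)
    assume none: "\<not> ?thesis"
    have "f (char_vec J) = f (char_vec (insert j J))" if "j \<notin> J" for J
    proof -
      have "f (char_vec J) \<le> f (char_vec (insert j J))"
        by (rule polynomial_mono[OF assms]) (auto simp: char_vec_def)
      moreover have "\<not> f (char_vec J) < f (char_vec (insert j J))"
        using none that by auto
      ultimately show ?thesis
        by (simp add: order.order_iff_strict)
    qed
    then have eq: "f (upd x j bot) = f (upd x j top)" for x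
      by (rule upd_eq_of_char_vec_eq[OF assms])
    \<comment> \<open>With both values equal to some \<open>c\<close>, the decomposition at
      \<open>j\<close> reads \<open>sup c (inf (x $ j) c)\<close>, which is \<open>c\<close> by
      absorption.\<close>
    have "f x = f (upd x j top)" for x
      using polynomial_decomposition[OF assms, of x j] eq[of x]
      by (simp add: inf.commute[of "x $ j"])
    \<comment> \<open>Setting coordinate \<open>j\<close> to \<open>top\<close> turns
      \<open>upd x j b\<close> and \<open>x\<close> into the same vector.\<close>
    then have "f (upd x j b) = f x" for x b
      by (metis upd_upd)
    with ess show False
      unfolding essential_def upd_def[symmetric] by auto
  qed
next
  assume "\<exists>J \<subseteq> UNIV - {j}. f (char_vec J) < f (char_vec (J \<union> {j}))"
  then obtain J where less: "f (char_vec J) < f (char_vec (J \<union> {j}))"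
    by blast
  have "char_vec (J \<union> {j}) = upd (char_vec J) j top"
    by (simp add: vec_eq_iff char_vec_def)
  with less have "f (char_vec J) \<noteq> f (upd (char_vec J) j top)"
    by (metis less_irrefl)
  then show "essential j f"
    unfolding essential_def upd_def by blast
qed

end
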